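(* For each integer $H\ge 1$ we have $R_2(H)=\lfloor\sqrt H\rfloor$, $$I_2(H)=2H+\lfloor\sqrt H\rfloor+2\lfloor\sqrt{H/2}\rfloor+2\lfloor\sqrt{H/3}\rfloor,$$ $$D_2(H)=2H+2\lfloor\sqrt H\rfloor+2\lfloor\sqrt{H/2}\rfloor+2\lfloor\sqrt{H/3}\rfloor.$$
   Context: A polynomial $f\in\mathbb{C}[X]$ is degenerate if it has two distinct roots whose quotient is a root of unity. $S_2(H)$ is the set of monic polynomials $X^2+a_1X+a_2\in\mathbb{Z}[X]$ that are degenerate with $|a_1|,|a_2|\le H$; $D_2(H)=|S_2(H)|$; $I_2(H)$ and $R_2(H)$ are the numbers of polynomials in $S_2(H)$ that are irreducible, respectively reducible, in $\mathbb{Q}[X]$. *)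

theory Defs
  imports Complex_Main "HOL-Computational_Algebra.Polynomial"
begin

definition root_of_unity :: "complex \<Rightarrow> bool" where
  "root_of_unity z \<longleftrightarrow> (\<exists>n::nat. n \<ge> 1 \<and> z ^ n = 1)"

(* The quotient is only meaningful for y \<noteq> 0, but no such side condition is needed:
   x / 0 = 0 in HOL, and 0 is not a root of unity. *)
definition degenerate :: "complex poly \<Rightarrow> bool" where
  "degenerate f \<longleftrightarrow>
     (\<exists>x y. poly f x = 0 \<and> poly f y = 0 \<and> x \<noteq> y \<and> root_of_unity (x / y))"

(* Coefficient lists are in ascending order: [:a2, a1, 1:] is X^2 + a1 X + a2. *)
definition S2 :: "nat \<Rightarrow> int poly set" where
  "S2 H = {[:a2, a1, 1:] | a1 a2. \<bar>a1\<bar> \<le> int H \<and> \<bar>a2\<bar> \<le> int H \<and>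
             degenerate (map_poly of_int [:a2, a1, 1:])}"

definition D2 :: "nat \<Rightarrow> nat" where
  "D2 H = card (S2 H)"

definition I2 :: "nat \<Rightarrow> nat" where
  "I2 H = card {f \<in> S2 H. irreducible (map_poly of_int f :: rat poly)}"

(* Elements of S2 H have degree 2, so they are neither zero nor units in Q[X];
   for them, reducible means not irreducible. *)
definition R2 :: "nat \<Rightarrow> nat" where
  "R2 H = card {f \<in> S2 H. \<not> irreducible (map_poly of_int f :: rat poly)}"

end

(* If x \<noteq> y are the roots and z = x / y is a root of unity, then z + 1/z = a1^2/a2 - 2 is an
   algebraic integer (by Dickson polynomials) and rational, hence an integer, and it lies in
   {-2,-1,0,1}. So a1^2 = k a2 with k in {0,1,2,3}, and each of these values does give a
   degenerate polynomial. The discriminant is (k - 4) a2, so only k = 0 allows rational roots. *)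
theory Submission
  imports Defs
begin

section \<open>Dickson polynomials and the integrality of z + 1/z\<close>

text \<open>These are the polynomials D_n = 2 T_n(X/2), with T_n the Chebyshev polynomials of the
  first kind; \<open>pCons 0\<close> is multiplication by X.\<close>

fun dickson :: "nat \<Rightarrow> int poly" where
  "dickson 0 = [:2:]"
| "dickson (Suc 0) = [:0, 1:]"
| "dickson (Suc (Suc n)) = pCons 0 (dickson (Suc n)) - dickson n"

text \<open>In the recurrence the subtracted term has degree two less, so the shifted term decides
  the degree and the leading coefficient. Monicity fails only for the constant
  \<open>dickson 0\<close>; for n > 0 it is what yields an integral equation.\<close>

lemma degree_dickson: "degree (dickson n) = n \<and> (n > 0 \<longrightarrow> coeff (dickson n) n = 1)"
proof (induction n rule: dickson.induct)
  case (3 n)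
  have nz: "dickson (Suc n) \<noteq> 0" using 3 by auto
  have c: "coeff (dickson n) (Suc (Suc n)) = 0"
    using 3 by (intro coeff_eq_0) auto
  have "degree (dickson n) < degree (pCons 0 (dickson (Suc n)))"
    using 3 nz by simp
  hence "degree (dickson (Suc (Suc n))) = degree (pCons 0 (dickson (Suc n)))"
    unfolding dickson.simps diff_conv_add_uminus by (intro degree_add_eq_left) simp
  thus ?case using 3 nz c by simp
qed auto

text \<open>The product (z + 1/z)(z^(n+1) + 1/z^(n+1)) has the four terms z^(n+2), z^n and their
  inverses; subtracting the value for n leaves exactly the value for n+2.\<close>

lemma poly_dickson:
  fixes z :: "'a :: field_char_0"
  assumes "z \<noteq> 0"
  shows "poly (map_poly of_int (dickson n)) (z + 1 / z) = z ^ n + 1 / z ^ n"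
proof (induction n rule: dickson.induct)
  case (3 n)
  have "map_poly of_int (dickson (Suc (Suc n))) =
      pCons 0 (map_poly of_int (dickson (Suc n))) - (map_poly of_int (dickson n) :: 'a poly)"
    by (intro poly_eqI) (simp add: coeff_map_poly coeff_pCons split: nat.split)
  hence "poly (map_poly of_int (dickson (Suc (Suc n)))) (z + 1 / z) =
      (z + 1 / z) * (z ^ Suc n + 1 / z ^ Suc n) - (z ^ n + 1 / z ^ n)"
    using 3 by (simp only: poly_diff poly_pCons add_0)
  also have "\<dots> = z ^ Suc (Suc n) + 1 / z ^ Suc (Suc n)"
    using assms by (simp add: field_simps)
  finally show ?case .
qed (simp_all add: map_poly_pCons)

text \<open>As z^n = 1, the value of D_n at z + 1/z is 2, so z + 1/z is a root of D_n - 2, which is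
  monic over the integers since n \<ge> 1.\<close>

lemma algebraic_int_add_inverse_root_of_unity:
  fixes z :: "'a :: field_char_0"
  assumes n: "n \<ge> 1" "z ^ n = 1"
  shows "algebraic_int (z + 1 / z)"
proof -
  have z: "z \<noteq> 0" using n by (auto simp: power_0_left)
  have "degree (dickson n + [:-2:]) = n"
    using degree_dickson[of n] n by (subst degree_add_eq_left) auto
  moreover have "coeff (dickson n + [:-2:]) n = 1"
    using degree_dickson[of n] n by (simp add: coeff_pCons split: nat.split)
  moreover have "poly (map_poly of_int (dickson n + [:-2:])) (z + 1 / z) = 0"
  proof -
    have "map_poly of_int (dickson n + [:-2:]) = map_poly of_int (dickson n) + [:-2 :: 'a:]"
      by (intro poly_eqI) (simp add: coeff_map_poly coeff_pCons split: nat.split)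
    thus ?thesis using poly_dickson[OF z, of n] n by simp
  qed
  ultimately show ?thesis unfolding algebraic_int_altdef_ipoly by metis
qed

text \<open>A rational algebraic integer is an integer, and |z| = 1 bounds it by 2 in absolute
  value. The value 2 would mean (z - 1)^2 = 0.\<close>

lemma rational_add_inverse_root_of_unity:
  assumes z: "root_of_unity z" "z \<noteq> 1" and rat: "z + 1 / z \<in> \<rat>"
  shows "z + 1 / z \<in> {-2, -1, 0, 1}"
proof -
  obtain n where n: "n \<ge> 1" "z ^ n = 1" using z by (auto simp: root_of_unity_def)
  have z0: "z \<noteq> 0" using n by (auto simp: power_0_left)
  have "z + 1 / z \<in> \<int>"
    using rational_algebraic_int_is_int algebraic_int_add_inverse_root_of_unity[OF n] rat by blast
  then obtain q :: int where q: "z + 1 / z = of_int q" by (auto elim: Ints_cases)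
  have "norm z ^ n = 1 ^ n" using n by (simp flip: norm_power)
  hence "norm z = 1" using n(1) by (intro power_eq_imp_eq_base[of _ n 1]) auto
  hence "norm (z + 1 / z) \<le> 2"
    using norm_triangle_ineq[of z "1 / z"] by (simp add: norm_divide)
  hence "\<bar>q\<bar> \<le> 2" unfolding q by simp
  moreover have "q \<noteq> 2"
  proof
    assume "q = 2"
    hence "(z - 1) ^ 2 = 0" using q z0 by (simp add: field_simps power2_eq_square)
    thus False using z by simp
  qed
  ultimately have "q \<in> {-2, -1, 0, 1}" by auto
  thus ?thesis unfolding q by auto
qed

section \<open>Degeneracy of monic integer quadratics\<close>

lemma poly_of_int_quadratic:
  "map_poly of_int [:c, b, 1 :: int:] = [:of_int c, of_int b, 1 :: 'a :: ring_char_0:]"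
  by (simp add: map_poly_pCons)

text \<open>By Vieta, x/y + y/x = ((x + y)^2 - 2xy)/(xy) = a1^2/a2 - 2. This is rational, so only
  four values are possible, and k is the value plus 2.\<close>

lemma degenerate_quadraticD:
  fixes a1 a2 :: int
  assumes "degenerate (map_poly of_int [:a2, a1, 1:])"
  shows "a2 \<noteq> 0" "\<exists>k\<in>{0, 1, 2, 3}. a1\<^sup>2 = k * a2"
proof -
  obtain x y where xy: "x\<^sup>2 + of_int a1 * x + of_int a2 = 0" "y\<^sup>2 + of_int a1 * y + of_int a2 = 0"
    "x \<noteq> y" and ru: "root_of_unity (x / y)"
    using assms unfolding degenerate_def poly_of_int_quadratic
    by (auto simp: algebra_simps power2_eq_square)
  have "x / y \<noteq> 0" using ru by (auto simp: root_of_unity_def power_0_left)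
  hence nz: "x \<noteq> 0" "y \<noteq> 0" by auto
  \<comment> \<open>The difference of the two root equations factors this way; cancelling x - y
    gives Vieta's formula for the sum.\<close>
  have "(x - y) * (x + y + of_int a1) = 0" using xy by algebra
  hence s: "of_int a1 = - (x + y)" using xy(3) by (simp add: eq_neg_iff_add_eq_0 add.commute del: minus_add_distrib)
  have p: "of_int a2 = x * y" using xy(1) s by algebra
  show a2: "a2 \<noteq> 0" using p nz by auto
  have t: "x / y + 1 / (x / y) = (of_int (a1\<^sup>2) - 2 * of_int a2) / of_int a2"
    using nz by (simp add: s p field_simps power2_eq_square)
  have "x / y + 1 / (x / y) \<in> \<rat>" unfolding t by simp
  moreover have "x / y \<noteq> 1" using xy(3) nz by simp
  ultimately have "x / y + 1 / (x / y) \<in> {-2, -1, 0, 1}"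
    using rational_add_inverse_root_of_unity ru by blast
  then obtain k :: int where k: "k \<in> {0, 1, 2, 3}" "x / y + 1 / (x / y) = of_int (k - 2)"
    by (force intro: that[of 0] that[of 1] that[of 2] that[of 3])
  have "of_int (a1\<^sup>2) = (of_int (k * a2) :: complex)"
    using k(2) a2 unfolding t by (simp add: field_simps)
  hence "a1\<^sup>2 = k * a2" using of_int_eq_iff by blast
  thus "\<exists>k\<in>{0, 1, 2, 3}. a1\<^sup>2 = k * a2" using k by blast
qed

text \<open>For k = 0, 1, 2, 3 the number z is a root of (X + 1)^2, X^2 + X + 1, X^2 + 1, X^2 - X +
  1, hence of order 2, 3, 4, 6 respectively.\<close>

lemma root_of_unity_add_inverse:
  assumes z: "z \<noteq> 0" and k: "k \<in> {0, 1, 2, 3 :: int}" "z + 1 / z = of_int (k - 2)"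
  shows "root_of_unity z"
proof -
  have e: "z\<^sup>2 = (of_int k - 2) * z - 1"
    using k(2) z by (simp add: field_simps power2_eq_square)
  from k(1) consider "k = 0" | "k = 1" | "k = 2" | "k = 3" by auto
  \<comment> \<open>12 is the least common multiple of the orders 2, 3, 4 and 6.\<close>
  then have "z ^ 12 = 1"
  proof cases
    case 1
    have "(z + 1)\<^sup>2 = z\<^sup>2 + 2 * z + 1" by (simp add: power2_eq_square algebra_simps)
    also have "\<dots> = 0" using e 1 by simp
    finally have "z = - 1" by (simp add: eq_neg_iff_add_eq_0)
    thus ?thesis by simp
  next
    case 2
    with e have "z\<^sup>2 = - z - 1" by simp
    hence "z ^ 3 = 1" by algebra
    hence "(z ^ 3) ^ 4 = 1" by simp
    thus ?thesis by (simp flip: power_mult)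
  next
    case 3
    with e have "z\<^sup>2 = - 1" by simp
    hence "(z\<^sup>2) ^ 6 = 1" by simp
    thus ?thesis by (simp flip: power_mult)
  next
    case 4
    with e have "z\<^sup>2 = z - 1" by simp
    hence "z ^ 3 = - 1" by algebra
    hence "(z ^ 3) ^ 4 = 1" by simp
    thus ?thesis by (simp flip: power_mult)
  qed
  thus ?thesis unfolding root_of_unity_def by (intro exI[of _ 12]) simp
qed

text \<open>The roots come from the quadratic formula. They are distinct because the discriminant (k
  - 4) a2 is nonzero, and their quotient z satisfies z + 1/z = k - 2.\<close>

lemma degenerate_quadraticI:
  fixes a1 a2 :: int
  assumes a2: "a2 \<noteq> 0" and k: "k \<in> {0, 1, 2, 3}" "a1\<^sup>2 = k * a2"
  shows "degenerate (map_poly of_int [:a2, a1, 1:])"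
proof -
  define d where "d = csqrt (of_int a1 ^ 2 - 4 * of_int a2)"
  define x where "x = (- of_int a1 + d) / 2"
  define y where "y = (- of_int a1 - d) / 2"
  have d2: "d\<^sup>2 = of_int a1 ^ 2 - 4 * of_int a2" unfolding d_def by simp
  have kc: "(of_int a1 :: complex)\<^sup>2 = of_int k * of_int a2"
    using k(2) by (metis of_int_mult of_int_power)
  have "d\<^sup>2 = of_int (k - 4) * of_int a2" unfolding d2 kc by (simp add: algebra_simps)
  moreover have "k - 4 \<noteq> 0" using k(1) by auto
  ultimately have "d\<^sup>2 \<noteq> 0" using a2 by (metis mult_eq_0_iff of_int_eq_0_iff)
  hence "d \<noteq> 0" by auto
  hence ne: "x \<noteq> y" by (simp add: x_def y_def)
  have s: "x + y = - of_int a1" by (simp add: x_def y_def field_simps)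
  have p: "x * y = of_int a2" using d2 by (simp add: x_def y_def field_simps power2_eq_square)
  have nz: "x \<noteq> 0" "y \<noteq> 0" using p a2 by auto
  have "x / y + 1 / (x / y) = ((x + y)\<^sup>2 - 2 * (x * y)) / (x * y)"
    using nz by (simp add: field_simps power2_eq_square)
  also have "\<dots> = of_int (k - 2)" using a2 kc unfolding s p by (simp add: field_simps)
  finally have "root_of_unity (x / y)"
    using nz k(1) by (intro root_of_unity_add_inverse) auto
  moreover have "poly [:of_int a2, of_int a1, 1:] x = 0" "poly [:of_int a2, of_int a1, 1:] y = 0"
    using s p by (simp_all, algebra+)
  ultimately show ?thesis unfolding degenerate_def poly_of_int_quadratic using ne by blast
qed

section \<open>Irreducibility of quadratics and rational square roots of integers\<close>

text \<open>In a factorisation into two non-units both factors are linear, and a linear polynomial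
  over a field has a root.\<close>

lemma irreducible_degree_2_iff:
  fixes p :: "'a :: field poly"
  assumes "degree p = 2"
  shows "irreducible p \<longleftrightarrow> (\<forall>x. poly p x \<noteq> 0)"
proof safe
  fix x assume irr: "irreducible p" and "poly p x = 0"
  then obtain q where q: "p = [:- x, 1:] * q" by (auto simp: poly_eq_0_iff_dvd)
  with assms have "q \<noteq> 0" by auto
  hence "degree q = 1" using assms q by (simp add: degree_mult_eq del: mult_pCons_left)
  moreover from irreducibleD[OF irr q] have "[:- x, 1:] dvd 1 \<or> q dvd 1" .
  ultimately show False by (auto simp: is_unit_iff_degree \<open>q \<noteq> 0\<close>)
next
  assume nr: "\<forall>x. poly p x \<noteq> 0"
  show "irreducible p"
  proof (rule irreducibleI)
    show "p \<noteq> 0" using assms by auto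
    thus "\<not> p dvd 1" using assms by (simp add: is_unit_iff_degree)
    fix a b assume ab: "p = a * b"
    with \<open>p \<noteq> 0\<close> have nz: "a \<noteq> 0" "b \<noteq> 0" by auto
    have no_linear: "degree q \<noteq> 1" if "q dvd p" for q
    proof
      assume "degree q = 1"
      then obtain c d where "q = [:c, d:]" "d \<noteq> 0"
        by (cases q, rename_tac d q') (auto split: if_splits elim!: degree_eq_zeroE)
      hence "poly q (- c / d) = 0" by simp
      with that nr show False by (auto elim!: dvdE)
    qed
    have "degree a + degree b = 2" using assms ab nz by (simp add: degree_mult_eq)
    moreover have "degree a \<noteq> 1" using no_linear ab by simp
    ultimately have "degree a = 0 \<or> degree b = 0" by linarith
    thus "a dvd 1 \<or> b dvd 1" using nz by (simp add: is_unit_iff_degree)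
  qed
qed

lemma rat_square_int:
  fixes r :: rat
  assumes "r\<^sup>2 = of_int m"
  obtains n :: nat where "m = int n ^ 2"
proof -
  have "algebraic_int (r\<^sup>2)" using assms by simp
  hence "algebraic_int r"
    \<comment> \<open>X^2 is monic of positive degree and takes the algebraic integer value r^2 at
      r, so r is integral as well.\<close>
    by (rule algebraic_int_root[where p = "monom 1 2"]) (auto simp: poly_monom degree_monom_eq)
  moreover have "r \<in> \<rat>" by (simp add: Rats_def)
  ultimately obtain i :: int where "r = of_int i"
    using rational_algebraic_int_is_int by (blast elim: Ints_cases)
  hence "m = i\<^sup>2" using assms by (metis of_int_eq_iff of_int_power)
  thus ?thesis using that[of "nat \<bar>i\<bar>"] by simp
qed

section \<open>The families that make up \<open>S2 H\<close>, and their sizes\<close>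

text \<open>Turns a bound on k b^2 into a symmetric interval for b, so that counting such b produces
  the floors in the formulas.\<close>

lemma abs_le_floor_sqrt_iff:
  fixes b :: int and k :: nat
  assumes "k > 0"
  shows "\<bar>b\<bar> \<le> \<lfloor>sqrt (real H / real k)\<rfloor> \<longleftrightarrow> int k * b\<^sup>2 \<le> int H"
proof -
  have "\<bar>b\<bar> \<le> \<lfloor>sqrt (real H / real k)\<rfloor> \<longleftrightarrow> \<bar>real_of_int b\<bar> \<le> sqrt (real H / real k)"
    by (simp add: le_floor_iff)
  also have "\<dots> \<longleftrightarrow> (real_of_int b)\<^sup>2 \<le> real H / real k"
    by (metis real_sqrt_abs real_sqrt_le_iff)
  also have "\<dots> \<longleftrightarrow> real_of_int (int k * b\<^sup>2) \<le> real_of_int (int H)"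
    using assms by (simp add: field_simps)
  finally show ?thesis by (simp only: of_int_le_iff)
qed

text \<open>For k = 1, 2, 3 this parametrises the solutions of a1^2 = k a2 with a2 nonzero. The
  bound on k b^2 also bounds the linear coefficient, as |kb| \<le> k b^2 for integers b.\<close>

definition square_family :: "nat \<Rightarrow> nat \<Rightarrow> int poly set" where
  "square_family k H = (\<lambda>b. [:int k * b\<^sup>2, int k * b, 1:]) ` {b. b \<noteq> 0 \<and> int k * b\<^sup>2 \<le> int H}"

text \<open>The case k = 0, where a1 = 0 and a2 is any nonzero integer in range.\<close>

definition even_family :: "nat \<Rightarrow> int poly set" where
  "even_family H = (\<lambda>c. [:c, 0, 1:]) ` ({- int H..int H} - {0})"

text \<open>The linear coefficient kb determines b, so it suffices to count a symmetric interval
  without 0.\<close>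

lemma card_square_family:
  assumes "k > 0"
  shows "finite (square_family k H)"
    and "int (card (square_family k H)) = 2 * \<lfloor>sqrt (real H / real k)\<rfloor>"
proof -
  let ?m = "\<lfloor>sqrt (real H / real k)\<rfloor>"
  have m: "?m \<ge> 0" by simp
  have B: "{b. b \<noteq> 0 \<and> int k * b\<^sup>2 \<le> int H} = {- ?m..?m} - {0}"
    unfolding abs_le_floor_sqrt_iff[OF assms, symmetric] by auto
  show "finite (square_family k H)" unfolding square_family_def B by simp
  have "inj (\<lambda>b. [:int k * b\<^sup>2, int k * b, 1:])" using assms by (auto intro: injI)
  hence "card (square_family k H) = card ({- ?m..?m} - {0})"
    unfolding square_family_def B by (intro card_image) (auto intro: inj_on_subset)
  also have "\<dots> = nat (2 * ?m)" using m by (subst card_Diff_subset) auto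
  finally show "int (card (square_family k H)) = 2 * ?m" using m by simp
qed

lemma card_even_family:
  "finite (even_family H)" "card (even_family H) = 2 * H"
proof -
  show "finite (even_family H)" unfolding even_family_def by simp
  have "card (even_family H) = card ({- int H..int H} - {0})"
    unfolding even_family_def by (intro card_image) (auto intro: inj_onI)
  also have "\<dots> = 2 * H" by (subst card_Diff_subset) auto
  finally show "card (even_family H) = 2 * H" .
qed

text \<open>Here it matters that k is 1 or prime: for k = 4 the conclusion fails, as 2^2 = 4 * 1
  shows.\<close>

lemma dvd_of_square_eq:
  fixes a c k :: int
  assumes "k \<in> {1, 2, 3}" "a\<^sup>2 = k * c"
  shows "k dvd a"
proof -
  have "k = 1 \<or> prime k" using assms(1) by auto
  moreover have "k dvd a\<^sup>2" using assms(2) by simp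
  ultimately show ?thesis by (auto dest: prime_dvd_power)
qed

text \<open>For k > 0, writing a1 = kb in a1^2 = k a2 and cancelling k gives a2 = k b^2.\<close>

lemma S2_eq:
  "S2 H = even_family H \<union> (square_family 1 H \<union> (square_family 2 H \<union> square_family 3 H))"
proof (intro equalityI subsetI)
  fix f assume "f \<in> S2 H"
  then obtain a1 a2 where f: "f = [:a2, a1, 1:]" "\<bar>a1\<bar> \<le> int H" "\<bar>a2\<bar> \<le> int H"
    "degenerate (map_poly of_int [:a2, a1, 1:])"
    unfolding S2_def by blast
  from degenerate_quadraticD[OF f(4)] obtain k where
    nz: "a2 \<noteq> 0" and k: "k \<in> {0, 1, 2, 3}" "a1\<^sup>2 = k * a2" by blast
  show "f \<in> even_family H \<union> (square_family 1 H \<union> (square_family 2 H \<union> square_family 3 H))"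
  proof (cases "k = 0")
    case True
    with k nz f have "f \<in> even_family H"
      unfolding even_family_def by (intro image_eqI[of _ _ a2]) auto
    thus ?thesis ..
  next
    case False
    hence k3: "k \<in> {1, 2, 3}" using k by auto
    obtain b where b: "a1 = k * b" using dvd_of_square_eq[OF k3 k(2)] by (auto elim: dvdE)
    have "k * a2 = k * (k * b\<^sup>2)" using k(2) b by algebra
    hence a2: "a2 = k * b\<^sup>2" using False mult_left_cancel by blast
    have "f \<in> square_family (nat k) H"
      unfolding square_family_def using f nz a2 b k3 by (intro image_eqI[of _ _ b]) auto
    thus ?thesis using k3 by auto
  qed
next
  have sq: "f \<in> S2 H" if "f \<in> square_family k H" "k \<in> {1, 2, 3}" for f k
  proof -
    from that obtain b where b: "f = [:int k * b\<^sup>2, int k * b, 1:]" "b \<noteq> 0" "int k * b\<^sup>2 \<le> int H"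
      unfolding square_family_def by blast
    \<comment> \<open>A nonzero integer satisfies 1 \<le> |b|; this carries the bound H from the
      constant to the linear coefficient.\<close>
    have "\<bar>b\<bar> * 1 \<le> \<bar>b\<bar> * \<bar>b\<bar>" using b(2) by (intro mult_left_mono) auto
    also have "\<dots> = b\<^sup>2" by (simp add: power2_eq_square)
    finally have "\<bar>int k * b\<bar> \<le> int k * b\<^sup>2" by (simp add: abs_mult mult_left_mono)
    moreover have "degenerate (map_poly of_int [:int k * b\<^sup>2, int k * b, 1:])"
      using that(2) b(2)
      by (intro degenerate_quadraticI[where k = "int k"]) (auto simp: power2_eq_square)
    ultimately show ?thesis unfolding S2_def using b by fastforce
  qed
  fix f assume "f \<in> even_family H \<union> (square_family 1 H \<union> (square_family 2 H \<union> square_family 3 H))"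
  moreover have "f \<in> S2 H" if "f \<in> even_family H"
  proof -
    from that obtain c where c: "f = [:c, 0, 1:]" "\<bar>c\<bar> \<le> int H" "c \<noteq> 0"
      unfolding even_family_def by fastforce
    have "degenerate (map_poly of_int [:c, 0, 1:])"
      using c by (intro degenerate_quadraticI[where k = 0]) auto
    thus ?thesis unfolding S2_def using c by fastforce
  qed
  ultimately show "f \<in> S2 H" using sq by blast
qed

text \<open>The ratio k = a1^2/a2 can be read off the polynomial: it is 0 on
  \<open>even_family H\<close> and k on \<open>square_family k H\<close>.\<close>

lemma families_disjoint:
  assumes "k > 0"
  shows "even_family H \<inter> square_family k H = {}"
    and "k \<noteq> l \<Longrightarrow> square_family k H \<inter> square_family l H = {}"
proof -
  show "even_family H \<inter> square_family k H = {}"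
    using assms unfolding even_family_def square_family_def by auto
  assume "k \<noteq> l"
  have False if eq: "int k * b = int l * c" "int k * b\<^sup>2 = int l * c\<^sup>2" and nz: "b \<noteq> 0" "c \<noteq> 0"
    for b c :: int
  proof -
    \<comment> \<open>Both sides equal l c^2; cancelling the nonzero kb gives b = c, and then k =
      l.\<close>
    have "(int k * b) * b = (int k * b) * c"
      using eq by (simp add: power2_eq_square algebra_simps)
    hence "b = c" using assms nz by simp
    thus False using eq(1) nz \<open>k \<noteq> l\<close> by simp
  qed
  thus "square_family k H \<inter> square_family l H = {}"
    unfolding square_family_def by auto
qed

lemma finite_S2_and_D2_eq:
  "finite (S2 H)"
  "int (D2 H) = 2 * int H + 2 * \<lfloor>sqrt (real H)\<rfloor>
     + 2 * \<lfloor>sqrt (real H / 2)\<rfloor> + 2 * \<lfloor>sqrt (real H / 3)\<rfloor>"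
proof -
  show "finite (S2 H)" unfolding S2_eq by (simp add: card_even_family card_square_family)
  have "card (S2 H) = card (even_family H) + (card (square_family 1 H)
          + (card (square_family 2 H) + card (square_family 3 H)))"
    unfolding S2_eq
    \<comment> \<open>Each round splits the leftmost family off the right-nested union.\<close>
    by (subst card_Un_disjoint;
        simp add: card_even_family card_square_family families_disjoint Int_Un_distrib)+
  thus "int (D2 H) = 2 * int H + 2 * \<lfloor>sqrt (real H)\<rfloor>
     + 2 * \<lfloor>sqrt (real H / 2)\<rfloor> + 2 * \<lfloor>sqrt (real H / 3)\<rfloor>"
    using card_square_family(2)[of 1 H] card_square_family(2)[of 2 H] card_square_family(2)[of 3 H]
    unfolding D2_def by (simp add: card_even_family)
qed

section \<open>The reducible members and the final counts\<close>

lemma reducible_monic_quadratic_iff: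
  "\<not> irreducible (map_poly of_int [:a2, a1, 1 :: int:] :: rat poly) \<longleftrightarrow>
     (\<exists>r :: rat. r\<^sup>2 + of_int a1 * r + of_int a2 = 0)"
  unfolding poly_of_int_quadratic
  by (subst irreducible_degree_2_iff) (auto simp: algebra_simps power2_eq_square)

text \<open>For k = 1, 2, 3 the discriminant -k(4 - k) b^2 is negative, which excludes rational
  roots. This leaves X^2 + c, which is reducible exactly when -c is a square.\<close>

lemma reducible_S2_eq:
  "{f \<in> S2 H. \<not> irreducible (map_poly of_int f :: rat poly)} =
     (\<lambda>n. [:- (int n ^ 2), 0, 1:]) ` {n. n \<ge> 1 \<and> n\<^sup>2 \<le> H}"
proof (intro equalityI subsetI)
  fix f assume f: "f \<in> {f \<in> S2 H. \<not> irreducible (map_poly of_int f :: rat poly)}"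
  have "f \<notin> square_family k H" if "k \<in> {1, 2, 3}" for k
  proof
    assume "f \<in> square_family k H"
    then obtain b where b: "f = [:int k * b\<^sup>2, int k * b, 1:]" "b \<noteq> 0"
      unfolding square_family_def by blast
    with f obtain r :: rat where
      r: "r\<^sup>2 + of_int (int k * b) * r + of_int (int k * b\<^sup>2) = 0"
      using reducible_monic_quadratic_iff by blast
    \<comment> \<open>Completing the square: a square plus minus the discriminant, the latter being
      positive.\<close>
    have "(2 * r + of_nat k * of_int b)\<^sup>2 + of_nat k * (4 - of_nat k) * (of_int b)\<^sup>2
            = 4 * (r\<^sup>2 + of_int (int k * b) * r + of_int (int k * b\<^sup>2))"
      by (simp add: power2_eq_square algebra_simps)
    hence "(2 * r + of_nat k * of_int b)\<^sup>2 + of_nat k * (4 - of_nat k) * (of_int b)\<^sup>2 = 0"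
      using r by simp
    moreover have "of_nat k * (4 - of_nat k) * (of_int b :: rat)\<^sup>2 > 0" using that b(2) by auto
    moreover have "(2 * r + of_nat k * of_int b)\<^sup>2 \<ge> 0" by simp
    ultimately show False by linarith
  qed
  hence "f \<in> even_family H" using f unfolding S2_eq by blast
  then obtain c where c: "f = [:c, 0, 1:]" "\<bar>c\<bar> \<le> int H" "c \<noteq> 0"
    unfolding even_family_def by fastforce
  with f obtain r :: rat where "r\<^sup>2 + of_int 0 * r + of_int c = 0"
    using reducible_monic_quadratic_iff by blast
  hence "r\<^sup>2 = of_int (- c)" by (simp add: eq_neg_iff_add_eq_0)
  then obtain n :: nat where n: "- c = int n ^ 2" by (rule rat_square_int)
  hence "c = - (int n ^ 2)" by simp
  moreover from this have "n \<ge> 1" using c by (cases n) auto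
  moreover have "n\<^sup>2 \<le> H" using n c(2) by (simp flip: of_nat_power)
  ultimately show "f \<in> (\<lambda>n. [:- (int n ^ 2), 0, 1:]) ` {n. n \<ge> 1 \<and> n\<^sup>2 \<le> H}"
    using c by auto
next
  fix f assume "f \<in> (\<lambda>n. [:- (int n ^ 2), 0, 1:]) ` {n. n \<ge> 1 \<and> n\<^sup>2 \<le> H}"
  then obtain n where n: "f = [:- (int n ^ 2), 0, 1:]" "n \<ge> 1" "n\<^sup>2 \<le> H" by auto
  have "int n ^ 2 \<le> int H" using n(3) by (simp flip: of_nat_power)
  hence "f \<in> even_family H" unfolding even_family_def using n
    \<comment> \<open>The upper end of the interval is checked through -n^2 \<le> 0 \<le> H.\<close>
    by (intro image_eqI[of _ _ "- (int n ^ 2)"]) (auto intro: order_trans[of _ 0])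
  moreover have "\<not> irreducible (map_poly of_int f :: rat poly)"
    unfolding n reducible_monic_quadratic_iff by (intro exI[of _ "of_nat n"]) simp
  ultimately show "f \<in> {f \<in> S2 H. \<not> irreducible (map_poly of_int f :: rat poly)}"
    unfolding S2_eq by blast
qed

lemma R2_eq: "int (R2 H) = \<lfloor>sqrt (real H)\<rfloor>"
proof -
  let ?m = "nat \<lfloor>sqrt (real H)\<rfloor>"
  have "n\<^sup>2 \<le> H \<longleftrightarrow> n \<le> ?m" for n
    using abs_le_floor_sqrt_iff[of 1 "int n" H] by (simp add: le_nat_iff flip: of_nat_power)
  hence B: "{n. n \<ge> 1 \<and> n\<^sup>2 \<le> H} = {1..?m}"
    by (simp only: set_eq_iff mem_Collect_eq atLeastAtMost_iff) blast
  have "R2 H = card {1..?m}"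
    unfolding R2_def reducible_S2_eq B by (intro card_image) (auto intro!: inj_onI)
  thus ?thesis by simp
qed

text \<open>The irreducible members are not counted directly: \<open>I2 H\<close> is recovered as
  the difference of \<open>D2 H\<close> and \<open>R2 H\<close>.\<close>

lemma D2_split: "D2 H = I2 H + R2 H"
proof -
  have "S2 H = {f \<in> S2 H. irreducible (map_poly of_int f :: rat poly)}
      \<union> {f \<in> S2 H. \<not> irreducible (map_poly of_int f :: rat poly)}" by blast
  thus ?thesis unfolding D2_def I2_def R2_def using finite_S2_and_D2_eq(1)[of H]
    by (subst card_Un_disjoint[symmetric]) auto
qed

theorem theorem6p1:
  fixes H :: nat
  assumes "H \<ge> 1"
  shows "int (R2 H) = \<lfloor>sqrt (real H)\<rfloor> \<and>
         int (I2 H) = 2 * int H + \<lfloor>sqrt (real H)\<rfloor>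
           + 2 * \<lfloor>sqrt (real H / 2)\<rfloor> + 2 * \<lfloor>sqrt (real H / 3)\<rfloor> \<and>
         int (D2 H) = 2 * int H + 2 * \<lfloor>sqrt (real H)\<rfloor>
           + 2 * \<lfloor>sqrt (real H / 2)\<rfloor> + 2 * \<lfloor>sqrt (real H / 3)\<rfloor>"
  using R2_eq[of H] finite_S2_and_D2_eq(2)[of H] D2_split[of H] by simp

end
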